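(* Let $G$ be a locally compact second countable group with a length function $L$. Let $\pi:G\to U(\mathcal{H})$ be a unitary representation such that $\mathcal{H}=L^2(X,m)$ with $(X,m)$ a measured space. Assume that $\pi$ is positive. The following conditions are equivalent: (1) There exist $d\ge 1$ and $C>0$ such that for all unit vectors $\xi,\eta\in\mathcal{H}$ we have $$\int_G\frac{|\langle\pi(g)\xi,\eta\rangle|^2}{(1+L(g))^d}\,dg<C$$ (that is, $\pi$ has property RD with respect to $L$). (2) For each $\xi\in\mathcal{H}_+$ there exists $d_\xi\ge 1$ such that $$\int_G\frac{\langle\pi(g)\xi,\xi\rangle^2}{(1+L(g))^{d_\xi}}\,dg<\infty.$$
   Context: $dg$ is a left Haar measure on $G$. A length function on a locally compact group $G$ is a measurable function $L:G\to\mathbb{R}_+$, bounded on each compact subset of $G$, with $L(e)=0$, $L(g^{-1})=L(g)$ and $L(gh)\le L(g)+L(h)$ for all $g,h\in G$. $L^2(X,m)$ is the space of complex valued square integrable functions with $\langle\xi,\eta\rangle=\int_X\xi\overline{\eta}\,dm$, and $\mathcal{H}_+=\{\xi\in\mathcal{H}:\xi\ge 0\ m\text{-almost everywhere}\}$. The representation $\pi$ is called positive if $\pi(g)\mathcal{H}_+\subset\mathcal{H}_+$ for all $g\in G$. *)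

theory Defs
  imports "HOL-Analysis.Analysis"
begin

text \<open>
  Groups are written additively, since the library's class of (not necessarily commutative)
  topological groups is \<^class>\<open>topological_group_add\<close>: the product of \<open>g\<close> and \<open>h\<close> is \<open>g + h\<close>,
  the inverse of \<open>g\<close> is \<open>- g\<close> and the neutral element is \<open>0\<close>.
\<close>

definition left_haar_measure :: "'g::topological_group_add measure \<Rightarrow> bool" where
  "left_haar_measure \<mu> \<longleftrightarrow>
     sets \<mu> = sets borel \<and>
     emeasure \<mu> UNIV \<noteq> 0 \<and>
     (\<forall>K. compact K \<longrightarrow> emeasure \<mu> K < \<infinity>) \<and>
     (\<forall>A\<in>sets \<mu>. emeasure \<mu> A = (INF U\<in>{U. open U \<and> A \<subseteq> U}. emeasure \<mu> U)) \<and>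
     (\<forall>U. open U \<longrightarrow> emeasure \<mu> U = (SUP K\<in>{K. compact K \<and> K \<subseteq> U}. emeasure \<mu> K)) \<and>
     (\<forall>g. \<forall>A\<in>sets \<mu>. emeasure \<mu> ((+) g ` A) = emeasure \<mu> A)"

definition length_function :: "('g::topological_group_add \<Rightarrow> real) \<Rightarrow> bool" where
  "length_function L \<longleftrightarrow>
     L \<in> borel_measurable borel \<and>
     (\<forall>g. 0 \<le> L g) \<and>
     (\<forall>K. compact K \<longrightarrow> bounded (L ` K)) \<and>
     L 0 = 0 \<and>
     (\<forall>g. L (- g) = L g) \<and>
     (\<forall>g h. L (g + h) \<le> L g + L h)"

text \<open>
  As usual, elements of $L^2(X,m)$ are represented by functions, and equality in $L^2(X,m)$ is
  equality almost everywhere.  Maps of $L^2(X,m)$ to itself are therefore maps on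
  representatives that respect equality almost everywhere, and every identity between
  vectors is asserted almost everywhere only.
\<close>

definition L2 :: "'x measure \<Rightarrow> ('x \<Rightarrow> complex) set" where
  "L2 M = {\<xi> \<in> borel_measurable M. integrable M (\<lambda>x. (cmod (\<xi> x))\<^sup>2)}"

definition L2_eq :: "'x measure \<Rightarrow> ('x \<Rightarrow> complex) \<Rightarrow> ('x \<Rightarrow> complex) \<Rightarrow> bool" where
  "L2_eq M \<xi> \<eta> \<longleftrightarrow> (AE x in M. \<xi> x = \<eta> x)"

definition L2_inner :: "'x measure \<Rightarrow> ('x \<Rightarrow> complex) \<Rightarrow> ('x \<Rightarrow> complex) \<Rightarrow> complex" where
  "L2_inner M \<xi> \<eta> = (LINT x|M. \<xi> x * cnj (\<eta> x))"

definition L2_norm :: "'x measure \<Rightarrow> ('x \<Rightarrow> complex) \<Rightarrow> real" where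
  "L2_norm M \<xi> = sqrt (LINT x|M. (cmod (\<xi> x))\<^sup>2)"

definition L2_pos :: "'x measure \<Rightarrow> ('x \<Rightarrow> complex) set" where
  "L2_pos M = {\<xi> \<in> L2 M. AE x in M. \<xi> x \<in> \<real>\<^sub>\<ge>\<^sub>0}"

definition unitary_operator :: "'x measure \<Rightarrow> (('x \<Rightarrow> complex) \<Rightarrow> ('x \<Rightarrow> complex)) \<Rightarrow> bool" where
  "unitary_operator M U \<longleftrightarrow>
     (\<forall>\<xi>\<in>L2 M. U \<xi> \<in> L2 M) \<and>
     (\<forall>\<xi>\<in>L2 M. \<forall>\<eta>\<in>L2 M. L2_eq M \<xi> \<eta> \<longrightarrow> L2_eq M (U \<xi>) (U \<eta>)) \<and>
     (\<forall>\<xi>\<in>L2 M. \<forall>\<eta>\<in>L2 M. L2_eq M (U (\<lambda>x. \<xi> x + \<eta> x)) (\<lambda>x. U \<xi> x + U \<eta> x)) \<and>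
     (\<forall>c. \<forall>\<xi>\<in>L2 M. L2_eq M (U (\<lambda>x. c * \<xi> x)) (\<lambda>x. c * U \<xi> x)) \<and>
     (\<forall>\<xi>\<in>L2 M. \<forall>\<eta>\<in>L2 M. L2_inner M (U \<xi>) (U \<eta>) = L2_inner M \<xi> \<eta>) \<and>
     (\<forall>\<eta>\<in>L2 M. \<exists>\<xi>\<in>L2 M. L2_eq M (U \<xi>) \<eta>)"

text \<open>
  Unitary representations of topological groups are, by convention, strongly continuous.
\<close>

definition unitary_representation ::
    "'x measure \<Rightarrow> ('g::topological_group_add \<Rightarrow> ('x \<Rightarrow> complex) \<Rightarrow> ('x \<Rightarrow> complex)) \<Rightarrow> bool" where
  "unitary_representation M \<pi> \<longleftrightarrow>
     (\<forall>g. unitary_operator M (\<pi> g)) \<and>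
     (\<forall>g h. \<forall>\<xi>\<in>L2 M. L2_eq M (\<pi> (g + h) \<xi>) (\<pi> g (\<pi> h \<xi>))) \<and>
     (\<forall>\<xi>\<in>L2 M. \<forall>h. ((\<lambda>g. L2_norm M (\<lambda>x. \<pi> g \<xi> x - \<pi> h \<xi> x)) \<longlongrightarrow> 0) (at h))"

definition positive_representation ::
    "'x measure \<Rightarrow> ('g \<Rightarrow> ('x \<Rightarrow> complex) \<Rightarrow> ('x \<Rightarrow> complex)) \<Rightarrow> bool" where
  "positive_representation M \<pi> \<longleftrightarrow> (\<forall>g. \<pi> g ` L2_pos M \<subseteq> L2_pos M)"

text \<open>
  The integrals over the group are integrals of nonnegative functions with values in
  $[0,\infty]$; in particular an infinite integral is never less than a finite bound.
  The exponent \<open>d\<close> is a real number.  (Where \<open>\<xi>\<close> is nonnegative and the representation is positive,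
  the inner product of \<open>\<pi> g \<xi>\<close> with \<open>\<xi>\<close> is a nonnegative real, i.e. equal to its real part.)
\<close>

definition property_RD_with ::
    "'g::topological_group_add measure \<Rightarrow> ('g \<Rightarrow> real) \<Rightarrow> 'x measure \<Rightarrow>
      ('g \<Rightarrow> ('x \<Rightarrow> complex) \<Rightarrow> ('x \<Rightarrow> complex)) \<Rightarrow> bool" where
  "property_RD_with \<mu> L M \<pi> \<longleftrightarrow>
     (\<exists>d::real. d \<ge> 1 \<and> (\<exists>C::real. C > 0 \<and>
       (\<forall>\<xi>\<in>L2 M. \<forall>\<eta>\<in>L2 M. L2_norm M \<xi> = 1 \<longrightarrow> L2_norm M \<eta> = 1 \<longrightarrow>
         (\<integral>\<^sup>+ g. ennreal ((cmod (L2_inner M (\<pi> g \<xi>) \<eta>))\<^sup>2 / (1 + L g) powr d) \<partial>\<mu>) < ennreal C)))"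

end

theory Submission
  imports Defs
begin

text \<open>
  For (2) implies (1), suppose RD fails and choose unit vectors \<open>\<xi> n\<close>, \<open>\<eta> n\<close> whose integral with
  exponent \<open>n + 1\<close> is at least \<open>8 ^ n\<close>. The single nonnegative vector \<open>v\<close> with
  \<open>v\<^sup>2 = (\<Sum>n. (\<bar>\<xi> n\<bar>\<^sup>2 + \<bar>\<eta> n\<bar>\<^sup>2) / 2 ^ n)\<close> dominates \<open>\<bar>\<xi> n\<bar>\<close> and \<open>\<bar>\<eta> n\<bar>\<close> up to the factor
  \<open>2 powr (n / 2)\<close>, so positivity bounds the coefficients of \<open>\<xi> n\<close>, \<open>\<eta> n\<close> by \<open>2 ^ (n + 1)\<close> times
  the diagonal coefficient of \<open>v\<close>. As \<open>8 ^ n\<close> outgrows \<open>4 ^ (n + 1)\<close>, no exponent makes the integral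
  for \<open>v\<close> finite.
\<close>

section \<open>Scaling of integrals of possibly nonmeasurable functions\<close>

text \<open>Only an inequality, since \<open>f\<close> need not be measurable; it spares proving measurability of
  matrix coefficients on the group.\<close>

lemma nn_integral_cmult_le:
  fixes f :: "'a \<Rightarrow> ennreal"
  assumes "c < \<infinity>"
  shows "c * (\<integral>\<^sup>+ x. f x \<partial>M) \<le> (\<integral>\<^sup>+ x. c * f x \<partial>M)"
proof -
  have "c * (\<integral>\<^sup>+ x. f x \<partial>M) =
      (SUP s\<in>{s. simple_function M s \<and> s \<le> f}. c * integral\<^sup>S M s)"
    unfolding nn_integral_def by (rule SUP_mult_left_ennreal)
  also have "\<dots> \<le> (\<integral>\<^sup>+ x. c * f x \<partial>M)"
  proof (rule SUP_least)
    fix s assume "s \<in> {s. simple_function M s \<and> s \<le> f}"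
    then have s: "simple_function M s" "\<And>x. s x \<le> f x"
      by (auto simp: le_fun_def)
    \<comment> \<open>A simple minorant \<open>s\<close> is measurable even when \<open>f\<close> is
      not, so the exact scaling rule applies to it.\<close>
    have "c * integral\<^sup>S M s = (\<integral>\<^sup>+ x. c * s x \<partial>M)"
      using s(1) by (simp add: nn_integral_cmult nn_integral_eq_simple_integral borel_measurable_simple_function)
    also have "\<dots> \<le> (\<integral>\<^sup>+ x. c * f x \<partial>M)"
      using s(2) by (intro nn_integral_mono mult_left_mono) auto
    finally show "c * integral\<^sup>S M s \<le> (\<integral>\<^sup>+ x. c * f x \<partial>M)" .
  qed
  finally show ?thesis .
qed

text \<open>\<open>nn_integral_cmult_le\<close> lets a factor only move inside the integral, whereas
  here it must come out. Moving \<open>1 / c\<close> inside and multiplying the result by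
  \<open>c\<close> has that effect.\<close>

lemma nn_integral_le_cmult:
  fixes f g :: "'a \<Rightarrow> real"
  assumes "c > 0" and "\<And>x. 0 \<le> g x" and "\<And>x. f x \<le> c * g x"
  shows "(\<integral>\<^sup>+ x. ennreal (f x) \<partial>M) \<le> ennreal c * (\<integral>\<^sup>+ x. ennreal (g x) \<partial>M)"
proof -
  have "ennreal (1 / c) * (\<integral>\<^sup>+ x. ennreal (f x) \<partial>M) \<le> (\<integral>\<^sup>+ x. ennreal (1 / c) * ennreal (f x) \<partial>M)"
    by (rule nn_integral_cmult_le) auto
  also have "\<dots> \<le> (\<integral>\<^sup>+ x. ennreal (g x) \<partial>M)"
  proof (rule nn_integral_mono)
    fix x
    have "f x / c \<le> g x"
      using assms by (simp add: field_simps)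
    then have "1 / c * f x \<le> g x"
      by simp
    then show "ennreal (1 / c) * ennreal (f x) \<le> ennreal (g x)"
      using assms(1) by (simp only: ennreal_mult'[symmetric] less_imp_le divide_nonneg_nonneg zero_le_one ennreal_leI)
  qed
  finally have "ennreal c * (ennreal (1 / c) * (\<integral>\<^sup>+ x. ennreal (f x) \<partial>M))
      \<le> ennreal c * (\<integral>\<^sup>+ x. ennreal (g x) \<partial>M)"
    by (rule mult_left_mono) simp
  moreover have "ennreal c * ennreal (1 / c) = 1"
    using assms(1) by (simp flip: ennreal_mult')
  ultimately show ?thesis
    by (simp flip: mult.assoc)
qed

section \<open>Closure properties of \<open>L2\<close> and integrability of inner products\<close>

lemma borel_measurable_cnj:
  assumes "f \<in> borel_measurable M"
  shows "(\<lambda>x. cnj (f x)) \<in> borel_measurable M"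
  by (rule borel_measurable_continuous_on[OF _ assms]) (intro continuous_intros)

lemma L2_dominated:
  assumes "\<xi> \<in> borel_measurable M" and "\<eta> \<in> L2 M" and "AE x in M. cmod (\<xi> x) \<le> cmod (\<eta> x)"
  shows "\<xi> \<in> L2 M"
proof -
  have "AE x in M. norm ((cmod (\<xi> x))\<^sup>2) \<le> norm ((cmod (\<eta> x))\<^sup>2)"
    using assms(3) by eventually_elim (simp add: power_mono)
  then show ?thesis
    using assms(1,2) unfolding L2_def
    by (auto intro: Bochner_Integration.integrable_bound)
qed

lemma L2_cmult:
  assumes "\<xi> \<in> L2 M"
  shows "(\<lambda>x. c * \<xi> x) \<in> L2 M"
  using assms by (auto simp: L2_def norm_mult power_mult_distrib)

lemma L2_add:
  assumes "\<xi> \<in> L2 M" and "\<eta> \<in> L2 M"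
  shows "(\<lambda>x. \<xi> x + \<eta> x) \<in> L2 M"
proof -
  have [measurable]: "\<xi> \<in> borel_measurable M" "\<eta> \<in> borel_measurable M"
    using assms by (auto simp: L2_def)
  have bound: "norm ((cmod (\<xi> x + \<eta> x))\<^sup>2) \<le> norm (2 * (cmod (\<xi> x))\<^sup>2 + 2 * (cmod (\<eta> x))\<^sup>2)" for x
  proof -
    have "(cmod (\<xi> x + \<eta> x))\<^sup>2 \<le> (cmod (\<xi> x) + cmod (\<eta> x))\<^sup>2"
      by (simp add: norm_triangle_ineq power_mono)
    also have "\<dots> \<le> 2 * (cmod (\<xi> x))\<^sup>2 + 2 * (cmod (\<eta> x))\<^sup>2"
      using sum_squares_bound[of "cmod (\<xi> x)" "cmod (\<eta> x)"] by (simp add: power2_sum)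
    finally show ?thesis by simp
  qed
  have "integrable M (\<lambda>x. 2 * (cmod (\<xi> x))\<^sup>2 + 2 * (cmod (\<eta> x))\<^sup>2)"
    using assms by (auto simp: L2_def)
  then have "integrable M (\<lambda>x. (cmod (\<xi> x + \<eta> x))\<^sup>2)"
    by (rule Bochner_Integration.integrable_bound) (use bound in auto)
  then show ?thesis
    by (simp add: L2_def)
qed

lemma integrable_L2_inner:
  assumes "\<xi> \<in> L2 M" and "\<eta> \<in> L2 M"
  shows "integrable M (\<lambda>x. \<xi> x * cnj (\<eta> x))"
proof -
  have [measurable]: "\<xi> \<in> borel_measurable M" "\<eta> \<in> borel_measurable M"
    using assms by (auto simp: L2_def)
  have bound: "norm (\<xi> x * cnj (\<eta> x)) \<le> norm ((cmod (\<xi> x))\<^sup>2 + (cmod (\<eta> x))\<^sup>2)" for x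
  proof -
    have "0 \<le> cmod (\<xi> x) * cmod (\<eta> x)"
      by simp
    with sum_squares_bound[of "cmod (\<xi> x)" "cmod (\<eta> x)"]
    have "cmod (\<xi> x) * cmod (\<eta> x) \<le> (cmod (\<xi> x))\<^sup>2 + (cmod (\<eta> x))\<^sup>2"
      by linarith
    then show ?thesis
      by (simp add: norm_mult)
  qed
  have "integrable M (\<lambda>x. (cmod (\<xi> x))\<^sup>2 + (cmod (\<eta> x))\<^sup>2)"
    using assms by (auto simp: L2_def)
  moreover have "(\<lambda>x. \<xi> x * cnj (\<eta> x)) \<in> borel_measurable M"
    by (intro borel_measurable_times borel_measurable_cnj) measurable
  ultimately show ?thesis
    by (rule Bochner_Integration.integrable_bound) (use bound in auto)
qed

section \<open>Domination under positive unitary operators\<close>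

text \<open>Adding and subtracting the two conditions shows that \<open>q\<close> is real and lies
  between \<open>- Re p\<close> and \<open>Re p\<close>. This turns the order information that
  positivity yields into a bound on the modulus.\<close>

lemma nonneg_Reals_pm_bound:
  fixes p q :: complex
  assumes "p + q \<in> \<real>\<^sub>\<ge>\<^sub>0" and "p - q \<in> \<real>\<^sub>\<ge>\<^sub>0"
  shows "cmod q \<le> Re p"
proof -
  have "Im q = 0" "\<bar>Re q\<bar> \<le> Re p"
    using assms by (auto simp: complex_nonneg_Reals_iff)
  then show ?thesis
    by (simp add: cmod_eq_Re)
qed

lemma unitary_operator_lincomb:
  assumes "unitary_operator M U" and "\<xi> \<in> L2 M" and "\<eta> \<in> L2 M"
  shows "AE x in M. U (\<lambda>x. a * \<xi> x + b * \<eta> x) x = a * U \<xi> x + b * U \<eta> x"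
proof -
  have "AE x in M. U (\<lambda>x. a * \<xi> x + b * \<eta> x) x = U (\<lambda>x. a * \<xi> x) x + U (\<lambda>x. b * \<eta> x) x"
    using assms L2_cmult[of \<xi> M a] L2_cmult[of \<eta> M b]
    by (auto simp: unitary_operator_def L2_eq_def)
  moreover have "AE x in M. U (\<lambda>x. a * \<xi> x) x = a * U \<xi> x" "AE x in M. U (\<lambda>x. b * \<eta> x) x = b * U \<eta> x"
    using assms by (auto simp: unitary_operator_def L2_eq_def)
  ultimately show ?thesis
    by eventually_elim simp
qed

text \<open>The hypothesis on \<open>f\<close> says that both \<open>c v + f\<close> and
  \<open>c v - f\<close> are nonnegative. Positivity and linearity of \<open>U\<close> give the same
  for \<open>c U v + U f\<close> and \<open>c U v - U f\<close>.\<close>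

lemma positive_operator_real_bound:
  assumes "unitary_operator M U" and "U ` L2_pos M \<subseteq> L2_pos M"
    and "v \<in> L2_pos M" and "(\<lambda>x. complex_of_real (f x)) \<in> L2 M"
    and "AE x in M. \<bar>f x\<bar> \<le> c * Re (v x)"
  shows "AE x in M. cmod (U (\<lambda>x. complex_of_real (f x)) x) \<le> c * Re (U v x)"
proof -
  have v: "v \<in> L2 M" "AE x in M. v x \<in> \<real>\<^sub>\<ge>\<^sub>0"
    using assms(3) by (auto simp: L2_pos_def)
  \<comment> \<open>The sign \<open>s\<close> is kept as a scalar so that both combinations are
    treated at once.\<close>
  have pos: "AE x in M. of_real c * U v x + s * U (\<lambda>x. complex_of_real (f x)) x \<in> \<real>\<^sub>\<ge>\<^sub>0"
    if s: "s = 1 \<or> s = - 1" for s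
  proof -
    have "AE x in M. of_real c * v x + s * complex_of_real (f x) \<in> \<real>\<^sub>\<ge>\<^sub>0"
      using assms(5) v(2)
      by eventually_elim (use s in \<open>auto simp: complex_nonneg_Reals_iff\<close>)
    then have "(\<lambda>x. of_real c * v x + s * complex_of_real (f x)) \<in> L2_pos M"
      unfolding L2_pos_def using assms(4) v(1) by (auto intro!: L2_add L2_cmult)
    then have "U (\<lambda>x. of_real c * v x + s * complex_of_real (f x)) \<in> L2_pos M"
      using assms(2) by blast
    then have "AE x in M. U (\<lambda>x. of_real c * v x + s * complex_of_real (f x)) x \<in> \<real>\<^sub>\<ge>\<^sub>0"
      by (simp add: L2_pos_def)
    with unitary_operator_lincomb[OF assms(1) v(1) assms(4), of "of_real c" s] show ?thesis
      by eventually_elim simp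
  qed
  from pos[of 1, OF disjI1[OF refl]] pos[of "- 1", OF disjI2[OF refl]] show ?thesis
  proof eventually_elim
    case (elim x)
    then have "cmod (U (\<lambda>x. complex_of_real (f x)) x) \<le> Re (of_real c * U v x)"
      by (intro nonneg_Reals_pm_bound) simp_all
    then show ?case
      by simp
  qed
qed

text \<open>The factor 2 comes from treating real and imaginary parts separately; the sharp constant 1
  would need a countable dense set of phases.\<close>

lemma positive_operator_bound:
  assumes "unitary_operator M U" and "U ` L2_pos M \<subseteq> L2_pos M"
    and "v \<in> L2_pos M" and "\<xi> \<in> L2 M"
    and "AE x in M. cmod (\<xi> x) \<le> c * Re (v x)"
  shows "AE x in M. cmod (U \<xi> x) \<le> 2 * c * Re (U v x)"
proof -
  have [measurable]: "\<xi> \<in> borel_measurable M"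
    using assms(4) by (auto simp: L2_def)
  have Re: "(\<lambda>x. complex_of_real (Re (\<xi> x))) \<in> L2 M" and Im: "(\<lambda>x. complex_of_real (Im (\<xi> x))) \<in> L2 M"
    by (rule L2_dominated[OF _ assms(4)]; simp add: abs_Re_le_cmod abs_Im_le_cmod)+
  have "AE x in M. \<bar>Re (\<xi> x)\<bar> \<le> c * Re (v x)"
    using assms(5) by eventually_elim (rule order_trans[OF abs_Re_le_cmod])
  note ReU = positive_operator_real_bound[OF assms(1-3) Re this]
  have "AE x in M. \<bar>Im (\<xi> x)\<bar> \<le> c * Re (v x)"
    using assms(5) by eventually_elim (rule order_trans[OF abs_Im_le_cmod])
  note ImU = positive_operator_real_bound[OF assms(1-3) Im this]
  \<comment> \<open>The explicit coefficient \<open>1\<close> puts the decomposition in the form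
    expected by \<open>unitary_operator_lincomb\<close>.\<close>
  have "\<xi> = (\<lambda>x. 1 * complex_of_real (Re (\<xi> x)) + \<i> * complex_of_real (Im (\<xi> x)))"
    by (simp flip: complex_eq)
  with unitary_operator_lincomb[OF assms(1) Re Im, of 1 \<i>]
  have "AE x in M. U \<xi> x = U (\<lambda>x. complex_of_real (Re (\<xi> x))) x + \<i> * U (\<lambda>x. complex_of_real (Im (\<xi> x))) x"
    by simp
  with ReU ImU show ?thesis
  proof eventually_elim
    case (elim x)
    have "cmod (U \<xi> x) \<le> cmod (U (\<lambda>x. complex_of_real (Re (\<xi> x))) x) + cmod (U (\<lambda>x. complex_of_real (Im (\<xi> x))) x)"
      unfolding elim(3) by (rule order_trans[OF norm_triangle_ineq]) (simp add: norm_mult)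
    with elim(1,2) show ?case
      by linarith
  qed
qed

text \<open>One diagonal coefficient controls all coefficients of dominated vectors: the pointwise
  bounds are multiplied and integrated. The factor \<open>2 * c\<close> comes from the bound on
  \<open>U \<xi>\<close> and the other \<open>c\<close> from the bound on \<open>\<eta>\<close>.
  Since \<open>U v\<close> and \<open>v\<close> are nonnegative almost everywhere, the product of
  their real parts is the real part of their product.\<close>

lemma positive_operator_inner_bound:
  assumes "unitary_operator M U" and "U ` L2_pos M \<subseteq> L2_pos M"
    and "v \<in> L2_pos M" and "\<xi> \<in> L2 M" and "\<eta> \<in> L2 M"
    and "AE x in M. cmod (\<xi> x) \<le> c * Re (v x)"
    and "AE x in M. cmod (\<eta> x) \<le> c * Re (v x)"
  shows "cmod (L2_inner M (U \<xi>) \<eta>) \<le> 2 * c\<^sup>2 * Re (L2_inner M (U v) v)"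
proof -
  have v: "v \<in> L2 M" "AE x in M. v x \<in> \<real>\<^sub>\<ge>\<^sub>0"
    using assms(3) by (auto simp: L2_pos_def)
  have "U v \<in> L2_pos M"
    using assms(2,3) by blast
  then have Uv: "U v \<in> L2 M" "AE x in M. U v x \<in> \<real>\<^sub>\<ge>\<^sub>0"
    by (auto simp: L2_pos_def)
  have U\<xi>: "U \<xi> \<in> L2 M"
    using assms(1,4) by (auto simp: unitary_operator_def)
  note int = integrable_L2_inner[OF Uv(1) v(1)]
  have "AE x in M. cmod (U \<xi> x * cnj (\<eta> x)) \<le> 2 * c\<^sup>2 * Re (U v x * cnj (v x))"
    using positive_operator_bound[OF assms(1-4,6)] assms(7) v(2) Uv(2)
  proof eventually_elim
    case (elim x)
    have "cmod (U \<xi> x) * cmod (\<eta> x) \<le> (2 * c * Re (U v x)) * (c * Re (v x))"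
      \<comment> \<open>That \<open>2 * c * Re (U v x)\<close> is nonnegative is read off from
        \<open>elim(1)\<close>, which places it above a norm.\<close>
      by (intro mult_mono elim(1,2) norm_ge_zero order_trans[OF norm_ge_zero elim(1)])
    with elim(3,4) show ?case
      by (simp add: norm_mult complex_nonneg_Reals_iff power2_eq_square mult_ac)
  qed
  then have "(LINT x|M. cmod (U \<xi> x * cnj (\<eta> x))) \<le> (LINT x|M. 2 * c\<^sup>2 * Re (U v x * cnj (v x)))"
    using integrable_L2_inner[OF U\<xi> assms(5)] int
    by (intro integral_mono_AE integrable_norm integrable_mult_right integrable_Re)
  also have "\<dots> = 2 * c\<^sup>2 * Re (L2_inner M (U v) v)"
    unfolding L2_inner_def integral_mult_right_zero integral_Re[OF int] ..
  finally show ?thesis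
    unfolding L2_inner_def by (rule order_trans[OF integral_norm_bound])
qed

section \<open>A single positive vector dominating a sequence\<close>

text \<open>The square of \<open>v\<close> is the sum of the \<open>f n\<close> with weights
  \<open>(1/2) ^ n\<close>. Its integral is at most \<open>2 * B\<close>, and comparison with a
  single summand costs the inverse weight \<open>2 ^ n\<close>.\<close>

lemma L2_common_majorant:
  fixes f :: "nat \<Rightarrow> 'x \<Rightarrow> real"
  assumes int: "\<And>n. integrable M (f n)" and nonneg: "\<And>n x. 0 \<le> f n x"
    and bound: "\<And>n. (LINT x|M. f n x) \<le> B"
  obtains v where "v \<in> L2_pos M" and "\<And>n. AE x in M. f n x \<le> 2 ^ n * (Re (v x))\<^sup>2"
proof
  define F where "F x = (\<Sum>n. ennreal ((1/2) ^ n * f n x))" for x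
  \<comment> \<open>\<open>enn2real\<close> sends an infinite sum to 0. This spoils the domination
    only on a null set, because the integral of \<open>F\<close> is finite.\<close>
  define v where "v x = complex_of_real (sqrt (enn2real (F x)))" for x
  have [measurable]: "f n \<in> borel_measurable M" for n
    using int by auto
  have F[measurable]: "F \<in> borel_measurable M"
    unfolding F_def by measurable
  have "(\<integral>\<^sup>+ x. F x \<partial>M) = (\<Sum>n. \<integral>\<^sup>+ x. ennreal ((1/2) ^ n * f n x) \<partial>M)"
    unfolding F_def by (rule nn_integral_suminf) measurable
  also have "\<dots> = (\<Sum>n. ennreal ((1/2) ^ n * (LINT x|M. f n x)))"
    using int nonneg by (subst nn_integral_eq_integral) auto
  also have "\<dots> \<le> (\<Sum>n. ennreal ((1/2) ^ n * B))"
    using bound by (intro suminf_le ennreal_leI mult_left_mono) auto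
  also have "\<dots> = ennreal (\<Sum>n. (1/2) ^ n * B)"
  proof (rule suminf_ennreal2)
    have "0 \<le> B"
      by (rule order_trans[OF _ bound[of 0]]) (simp add: nonneg)
    then show "0 \<le> (1/2) ^ n * B" for n
      by simp
    show "summable (\<lambda>n. (1/2) ^ n * B)"
      by (intro summable_mult2 summable_geometric) simp
  qed
  finally have fin: "(\<integral>\<^sup>+ x. F x \<partial>M) < \<infinity>"
    by (rule le_less_trans) simp
  then have AE_fin: "AE x in M. F x < \<infinity>"
    using nn_integral_PInf_AE[OF F] by (auto simp: less_top)
  have "integrable M (\<lambda>x. enn2real (F x))"
  proof (rule integrableI_bounded)
    have "(\<integral>\<^sup>+ x. ennreal (norm (enn2real (F x))) \<partial>M) = (\<integral>\<^sup>+ x. F x \<partial>M)"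
      using AE_fin by (intro nn_integral_cong_AE) (auto simp: less_top)
    with fin show "(\<integral>\<^sup>+ x. ennreal (norm (enn2real (F x))) \<partial>M) < \<infinity>"
      by simp
  qed measurable
  moreover have "v \<in> borel_measurable M"
    unfolding v_def by measurable
  ultimately show "v \<in> L2_pos M"
    by (simp add: L2_pos_def L2_def v_def)
  fix n
  show "AE x in M. f n x \<le> 2 ^ n * (Re (v x))\<^sup>2"
    using AE_fin
  proof eventually_elim
    case (elim x)
    have "ennreal ((1/2) ^ n * f n x) \<le> F x"
      using sum_le_suminf[of "\<lambda>n. ennreal ((1/2) ^ n * f n x)" "{n}"] by (simp add: F_def)
    also have "F x = ennreal (enn2real (F x))"
      using elim by simp
    finally have "(1/2) ^ n * f n x \<le> enn2real (F x)"
      by (simp add: ennreal_le_iff)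
    then show ?case
      by (simp add: v_def power_divide field_simps)
  qed
qed

section \<open>From RD to diagonal coefficients\<close>

lemma L2_norm_cmult:
  "L2_norm M (\<lambda>x. c * \<xi> x) = cmod c * L2_norm M \<xi>"
  by (simp add: L2_norm_def norm_mult power_mult_distrib real_sqrt_mult)

text \<open>The two slots contribute \<open>c\<close> and \<open>cnj c\<close>, whose product is
  real. Homogeneity of \<open>U\<close> holds almost everywhere, which suffices under the
  integral.\<close>

lemma L2_inner_unitary_scale:
  assumes "unitary_operator M U" and "\<xi> \<in> L2 M"
  shows "L2_inner M (U (\<lambda>x. c * \<xi> x)) (\<lambda>x. c * \<xi> x) = (cmod c)\<^sup>2 * L2_inner M (U \<xi>) \<xi>"
proof -
  have meas: "U (\<lambda>x. c * \<xi> x) \<in> borel_measurable M" "U \<xi> \<in> borel_measurable M" "\<xi> \<in> borel_measurable M"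
    using assms L2_cmult[OF assms(2), of c] by (auto simp: unitary_operator_def L2_def)
  note [measurable] = meas borel_measurable_cnj
  have "AE x in M. U (\<lambda>x. c * \<xi> x) x = c * U \<xi> x"
    using assms by (auto simp: unitary_operator_def L2_eq_def)
  then have "AE x in M. U (\<lambda>x. c * \<xi> x) x * cnj (c * \<xi> x) = (cmod c)\<^sup>2 * (U \<xi> x * cnj (\<xi> x))"
    by eventually_elim (simp add: complex_norm_square mult_ac del: of_real_power)
  then have "L2_inner M (U (\<lambda>x. c * \<xi> x)) (\<lambda>x. c * \<xi> x) =
      (LINT x|M. (cmod c)\<^sup>2 * (U \<xi> x * cnj (\<xi> x)))"
    unfolding L2_inner_def by (intro integral_cong_AE) (simp_all, measurable)
  then show ?thesis
    by (simp add: L2_inner_def)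
qed

text \<open>Settles the vectors that cannot be normalised: they vanish almost everywhere.\<close>

lemma L2_inner_eq_0_if_norm_0:
  assumes "\<eta> \<in> L2 M" and "L2_norm M \<eta> = 0" and "\<xi> \<in> borel_measurable M"
  shows "L2_inner M \<xi> \<eta> = 0"
proof -
  have "AE x in M. (cmod (\<eta> x))\<^sup>2 = 0"
    using assms by (subst integral_nonneg_eq_0_iff_AE[symmetric]) (auto simp: L2_def L2_norm_def)
  then have "AE x in M. \<xi> x * cnj (\<eta> x) = 0"
    by eventually_elim simp
  then show ?thesis
    unfolding L2_inner_def by (rule integral_eq_zero_AE)
qed

text \<open>RD is applied to the normalised vector in both slots, and its exponent serves every
  \<open>\<xi>\<close>.\<close>

lemma property_RD_imp_diagonal:
  assumes "property_RD_with \<mu> L M \<pi>" and "\<And>g. unitary_operator M (\<pi> g)" and \<xi>: "\<xi> \<in> L2 M"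
  shows "\<exists>d::real. d \<ge> 1 \<and>
    (\<integral>\<^sup>+ g. ennreal ((Re (L2_inner M (\<pi> g \<xi>) \<xi>))\<^sup>2 / (1 + L g) powr d) \<partial>\<mu>) < \<infinity>"
proof -
  obtain d C :: real where d: "d \<ge> 1" and
    RD: "\<And>\<xi> \<eta>. \<lbrakk>\<xi> \<in> L2 M; \<eta> \<in> L2 M; L2_norm M \<xi> = 1; L2_norm M \<eta> = 1\<rbrakk> \<Longrightarrow>
         (\<integral>\<^sup>+ g. ennreal ((cmod (L2_inner M (\<pi> g \<xi>) \<eta>))\<^sup>2 / (1 + L g) powr d) \<partial>\<mu>) < ennreal C"
    using assms(1) unfolding property_RD_with_def by blast
  have "(\<integral>\<^sup>+ g. ennreal ((Re (L2_inner M (\<pi> g \<xi>) \<xi>))\<^sup>2 / (1 + L g) powr d) \<partial>\<mu>) < \<infinity>"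
  proof (cases "L2_norm M \<xi> = 0")
    case True
    have "\<pi> g \<xi> \<in> borel_measurable M" for g
      using assms(2)[of g] \<xi> by (auto simp: unitary_operator_def L2_def)
    with \<xi> True show ?thesis
      by (simp add: L2_inner_eq_0_if_norm_0)
  next
    case False
    define N where "N = L2_norm M \<xi>"
    have N: "N > 0"
      using False by (simp add: N_def L2_norm_def less_le)
    define \<xi>' where "\<xi>' = (\<lambda>x. complex_of_real (1 / N) * \<xi> x)"
    have \<xi>': "\<xi>' \<in> L2 M" "L2_norm M \<xi>' = 1"
      using N unfolding \<xi>'_def L2_norm_cmult
      by (simp_all only: L2_cmult[OF \<xi>] N_def[symmetric]) (simp add: norm_divide)
    have inner: "L2_inner M (\<pi> g \<xi>') \<xi>' = L2_inner M (\<pi> g \<xi>) \<xi> / of_real (N\<^sup>2)" for g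
      using L2_inner_unitary_scale[OF assms(2) \<xi>, of g "complex_of_real (1 / N)"]
      by (simp add: \<xi>'_def norm_divide power_divide)
    \<comment> \<open>The diagonal coefficient is quadratic in the vector and is squared in the
      integrand, hence the fourth power of the norm.\<close>
    have "(\<integral>\<^sup>+ g. ennreal ((Re (L2_inner M (\<pi> g \<xi>) \<xi>))\<^sup>2 / (1 + L g) powr d) \<partial>\<mu>)
        \<le> ennreal (N ^ 4) * (\<integral>\<^sup>+ g. ennreal ((cmod (L2_inner M (\<pi> g \<xi>') \<xi>'))\<^sup>2 / (1 + L g) powr d) \<partial>\<mu>)"
    proof (rule nn_integral_le_cmult)
      fix g
      have "(Re (L2_inner M (\<pi> g \<xi>) \<xi>))\<^sup>2 \<le> (cmod (L2_inner M (\<pi> g \<xi>) \<xi>))\<^sup>2"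
        by (simp add: abs_le_square_iff[symmetric] abs_Re_le_cmod)
      also have "\<dots> = N ^ 4 * (cmod (L2_inner M (\<pi> g \<xi>') \<xi>'))\<^sup>2"
        unfolding inner using N by (simp add: norm_divide norm_power power_divide flip: power_mult)
      finally show "(Re (L2_inner M (\<pi> g \<xi>) \<xi>))\<^sup>2 / (1 + L g) powr d
          \<le> N ^ 4 * ((cmod (L2_inner M (\<pi> g \<xi>') \<xi>'))\<^sup>2 / (1 + L g) powr d)"
        by (simp add: divide_right_mono)
    qed (use N in auto)
    also have "\<dots> < \<infinity>"
      using RD[OF \<xi>'(1) \<xi>'(1) \<xi>'(2) \<xi>'(2)] by (auto simp: ennreal_mult_less_top intro: less_trans)
    finally show ?thesis .
  qed
  with d show ?thesis
    by blast
qed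

section \<open>From diagonal coefficients to RD\<close>

lemma diagonal_imp_property_RD:
  assumes unitary: "\<And>g. unitary_operator M (\<pi> g)" and pos: "\<And>g. \<pi> g ` L2_pos M \<subseteq> L2_pos M"
    and L: "\<And>g. 0 \<le> L g"
    and diag: "\<And>\<xi>. \<xi> \<in> L2_pos M \<Longrightarrow> \<exists>d::real. d \<ge> 1 \<and>
      (\<integral>\<^sup>+ g. ennreal ((Re (L2_inner M (\<pi> g \<xi>) \<xi>))\<^sup>2 / (1 + L g) powr d) \<partial>\<mu>) < \<infinity>"
  shows "property_RD_with \<mu> L M \<pi>"
proof (rule ccontr)
  assume nRD: "\<not> property_RD_with \<mu> L M \<pi>"
  \<comment> \<open>The failure of RD is used once for each \<open>n\<close>, with exponent
    \<open>Suc n\<close> and bound \<open>8 ^ n\<close>. The shift keeps the exponent at least 1, as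
    RD demands.\<close>
  have "\<forall>n. \<exists>\<xi> \<eta>. \<xi> \<in> L2 M \<and> \<eta> \<in> L2 M \<and> L2_norm M \<xi> = 1 \<and> L2_norm M \<eta> = 1 \<and>
      ennreal (8 ^ n) \<le>
      (\<integral>\<^sup>+ g. ennreal ((cmod (L2_inner M (\<pi> g \<xi>) \<eta>))\<^sup>2 / (1 + L g) powr real (Suc n)) \<partial>\<mu>)"
  proof (intro allI, rule ccontr)
    fix n
    assume "\<not> (\<exists>\<xi> \<eta>. \<xi> \<in> L2 M \<and> \<eta> \<in> L2 M \<and> L2_norm M \<xi> = 1 \<and> L2_norm M \<eta> = 1 \<and>
      ennreal (8 ^ n) \<le>
      (\<integral>\<^sup>+ g. ennreal ((cmod (L2_inner M (\<pi> g \<xi>) \<eta>))\<^sup>2 / (1 + L g) powr real (Suc n)) \<partial>\<mu>))"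
    then have "real (Suc n) \<ge> 1 \<and> (8::real) ^ n > 0 \<and> (\<forall>\<xi>\<in>L2 M. \<forall>\<eta>\<in>L2 M. L2_norm M \<xi> = 1 \<longrightarrow> L2_norm M \<eta> = 1 \<longrightarrow>
      (\<integral>\<^sup>+ g. ennreal ((cmod (L2_inner M (\<pi> g \<xi>) \<eta>))\<^sup>2 / (1 + L g) powr real (Suc n)) \<partial>\<mu>) < ennreal (8 ^ n))"
      by (auto simp: not_le)
    then show False
      using nRD unfolding property_RD_with_def by blast
  qed
  then obtain \<xi> \<eta> where \<xi>: "\<And>n. \<xi> n \<in> L2 M" "\<And>n. L2_norm M (\<xi> n) = 1"
    and \<eta>: "\<And>n. \<eta> n \<in> L2 M" "\<And>n. L2_norm M (\<eta> n) = 1"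
    and large: "\<And>n. ennreal (8 ^ n) \<le>
      (\<integral>\<^sup>+ g. ennreal ((cmod (L2_inner M (\<pi> g (\<xi> n)) (\<eta> n)))\<^sup>2 / (1 + L g) powr real (Suc n)) \<partial>\<mu>)"
    unfolding choice_iff by blast
  obtain v where v: "v \<in> L2_pos M" and
    dom: "\<And>n. AE x in M. (cmod (\<xi> n x))\<^sup>2 + (cmod (\<eta> n x))\<^sup>2 \<le> 2 ^ n * (Re (v x))\<^sup>2"
  \<comment> \<open>The bound 2 is the sum of two squared unit norms.\<close>
  proof (rule L2_common_majorant[where f = "\<lambda>n x. (cmod (\<xi> n x))\<^sup>2 + (cmod (\<eta> n x))\<^sup>2" and B = 2 and M = M])
    fix n
    have int: "integrable M (\<lambda>x. (cmod (\<xi> n x))\<^sup>2)" "integrable M (\<lambda>x. (cmod (\<eta> n x))\<^sup>2)"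
      using \<xi>(1) \<eta>(1) by (auto simp: L2_def)
    then show "integrable M (\<lambda>x. (cmod (\<xi> n x))\<^sup>2 + (cmod (\<eta> n x))\<^sup>2)"
      by simp
    show "(LINT x|M. (cmod (\<xi> n x))\<^sup>2 + (cmod (\<eta> n x))\<^sup>2) \<le> 2"
      using int \<xi>(2)[of n] \<eta>(2)[of n] by (simp add: L2_norm_def)
  qed auto
  have "AE x in M. 0 \<le> Re (v x)"
    using v by (auto simp: L2_pos_def complex_nonneg_Reals_iff)
  \<comment> \<open>Each square is at most the sum of the two, and the root may be taken because
    \<open>Re (v x)\<close> is nonnegative almost everywhere.\<close>
  then have dom': "AE x in M. cmod (\<xi> n x) \<le> sqrt (2 ^ n) * Re (v x) \<and>
      cmod (\<eta> n x) \<le> sqrt (2 ^ n) * Re (v x)" for n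
    using dom[of n]
  proof eventually_elim
    case (elim x)
    have "(cmod (\<xi> n x))\<^sup>2 \<le> (sqrt (2 ^ n) * Re (v x))\<^sup>2"
      "(cmod (\<eta> n x))\<^sup>2 \<le> (sqrt (2 ^ n) * Re (v x))\<^sup>2"
      unfolding power_mult_distrib real_sqrt_pow2[OF zero_le_power[OF zero_le_numeral]]
      using elim(2) zero_le_power2[of "cmod (\<xi> n x)"] zero_le_power2[of "cmod (\<eta> n x)"] by linarith+
    with elim(1) show ?case
      by (intro conjI power2_le_imp_le[of "cmod _"]) simp_all
  qed
  \<comment> \<open>With \<open>c = sqrt (2 ^ n)\<close> the constant \<open>2 * c\<^sup>2\<close>
    becomes \<open>2 ^ Suc n\<close>.\<close>
  have coeff: "cmod (L2_inner M (\<pi> g (\<xi> n)) (\<eta> n)) \<le> 2 ^ Suc n * Re (L2_inner M (\<pi> g v) v)" for g n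
    using positive_operator_inner_bound[OF unitary pos v \<xi>(1) \<eta>(1), of n "sqrt (2 ^ n)" n] dom'[of n]
    by simp
  obtain d :: real where d:
    "(\<integral>\<^sup>+ g. ennreal ((Re (L2_inner M (\<pi> g v) v))\<^sup>2 / (1 + L g) powr d) \<partial>\<mu>) < \<infinity>"
    using diag[OF v] by blast
  then obtain I where I: "0 \<le> I"
    "(\<integral>\<^sup>+ g. ennreal ((Re (L2_inner M (\<pi> g v) v))\<^sup>2 / (1 + L g) powr d) \<partial>\<mu>) = ennreal I"
    by (cases "\<integral>\<^sup>+ g. ennreal ((Re (L2_inner M (\<pi> g v) v))\<^sup>2 / (1 + L g) powr d) \<partial>\<mu>") auto
  \<comment> \<open>The index has two tasks: \<open>d \<le> n\<close> makes the weight with exponent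
    \<open>Suc n\<close> at least as large as the one with exponent \<open>d\<close>, and
    \<open>4 * I < n\<close> contradicts the final bound on \<open>2 ^ n\<close>.\<close>
  obtain n where "max d (4 * I) < real n"
    using reals_Archimedean2 by blast
  then have n: "d \<le> real n" "4 * I < real n"
    by simp_all
  have "ennreal (8 ^ n) \<le>
      ennreal (4 ^ Suc n) * (\<integral>\<^sup>+ g. ennreal ((Re (L2_inner M (\<pi> g v) v))\<^sup>2 / (1 + L g) powr d) \<partial>\<mu>)"
  proof (rule order_trans[OF large nn_integral_le_cmult])
    fix g
    have "(cmod (L2_inner M (\<pi> g (\<xi> n)) (\<eta> n)))\<^sup>2 \<le> (2 ^ Suc n * Re (L2_inner M (\<pi> g v) v))\<^sup>2"
      by (intro power_mono coeff) simp
    also have "\<dots> = 4 ^ Suc n * (Re (L2_inner M (\<pi> g v) v))\<^sup>2"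
      by (simp add: power_mult_distrib power2_eq_square flip: power_mult_distrib)
    finally have num: "(cmod (L2_inner M (\<pi> g (\<xi> n)) (\<eta> n)))\<^sup>2 \<le> 4 ^ Suc n * (Re (L2_inner M (\<pi> g v) v))\<^sup>2" .
    \<comment> \<open>Here \<open>0 \<le> L g\<close> enters: the base is at least 1, so powers grow
      with the exponent.\<close>
    have "(1 + L g) powr d \<le> (1 + L g) powr real (Suc n)" "0 < (1 + L g) powr d"
      using n(1) L[of g] by (auto intro: powr_mono)
    with num have "(cmod (L2_inner M (\<pi> g (\<xi> n)) (\<eta> n)))\<^sup>2 / (1 + L g) powr real (Suc n)
        \<le> 4 ^ Suc n * (Re (L2_inner M (\<pi> g v) v))\<^sup>2 / (1 + L g) powr d"
      by (intro frac_le) auto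
    then show "(cmod (L2_inner M (\<pi> g (\<xi> n)) (\<eta> n)))\<^sup>2 / (1 + L g) powr real (Suc n)
        \<le> 4 ^ Suc n * ((Re (L2_inner M (\<pi> g v) v))\<^sup>2 / (1 + L g) powr d)"
      by simp
  qed auto
  then have "ennreal (8 ^ n) \<le> ennreal (4 ^ Suc n * I)"
    using I by (simp add: ennreal_mult)
  then have "(8::real) ^ n \<le> 4 ^ Suc n * I"
    using I(1) by (subst (asm) ennreal_le_iff) auto
  \<comment> \<open>Cancelling \<open>4 ^ n\<close> leaves \<open>2 ^ n\<close> on one side and a
    bound free of \<open>n\<close> on the other.\<close>
  moreover have "(8::real) ^ n = 4 ^ n * 2 ^ n"
    by (simp flip: power_mult_distrib)
  ultimately have "(2::real) ^ n \<le> 4 * I"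
    by simp
  with n(2) of_nat_less_two_power[of n, where 'a = real] show False
    by linarith
qed

section \<open>Equivalence of RD with finiteness on the positive cone\<close>

theorem proposition1p2:
  fixes \<mu> :: "'g::{topological_group_add, t2_space, second_countable_topology} measure"
    and L :: "'g \<Rightarrow> real"
    and M :: "'x measure"
    and \<pi> :: "'g \<Rightarrow> ('x \<Rightarrow> complex) \<Rightarrow> ('x \<Rightarrow> complex)"
  assumes "locally_compact_space (euclidean :: 'g topology)"
    and "left_haar_measure \<mu>"
    and "length_function L"
    and "unitary_representation M \<pi>"
    and "positive_representation M \<pi>"
  shows "property_RD_with \<mu> L M \<pi> \<longleftrightarrow>
    (\<forall>\<xi>\<in>L2_pos M. \<exists>d::real. d \<ge> 1 \<and>
      (\<integral>\<^sup>+ g. ennreal ((Re (L2_inner M (\<pi> g \<xi>) \<xi>))\<^sup>2 / (1 + L g) powr d) \<partial>\<mu>) < \<infinity>)"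
proof
  have unitary: "\<And>g. unitary_operator M (\<pi> g)"
    using assms(4) by (simp add: unitary_representation_def)
  show "\<forall>\<xi>\<in>L2_pos M. \<exists>d::real. d \<ge> 1 \<and>
      (\<integral>\<^sup>+ g. ennreal ((Re (L2_inner M (\<pi> g \<xi>) \<xi>))\<^sup>2 / (1 + L g) powr d) \<partial>\<mu>) < \<infinity>"
    if "property_RD_with \<mu> L M \<pi>"
    \<comment> \<open>RD gives finiteness for every vector of \<open>L2 M\<close>, in particular for
      those of the cone.\<close>
    using property_RD_imp_diagonal[OF that unitary] by (simp add: L2_pos_def)
  show "property_RD_with \<mu> L M \<pi>"
    if "\<forall>\<xi>\<in>L2_pos M. \<exists>d::real. d \<ge> 1 \<and>
      (\<integral>\<^sup>+ g. ennreal ((Re (L2_inner M (\<pi> g \<xi>) \<xi>))\<^sup>2 / (1 + L g) powr d) \<partial>\<mu>) < \<infinity>"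
    using that assms(3,5)
    by (intro diagonal_imp_property_RD unitary)
      (auto simp: length_function_def positive_representation_def)
qed

end
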